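(* Let $D$ be a diagram of an oriented link and let $\alpha$ be a state cycle in the rational Khovanov complex of $D$ which is 1-even and 1-isolated. Then $\alpha$ represents a nontrivial homology class in Khovanov homology.
   Context: Khovanov complex (coefficients in $\mathbb{Q}$, unreduced). Let $D$ be a diagram of an oriented link with its crossings in a fixed order. Each crossing has a 0-smoothing and a 1-smoothing (the standard convention, in which the smoothing consistent with orientation is the 0-smoothing at a positive crossing and the 1-smoothing at a negative crossing). A state $\sigma$ is a choice of smoothing at every crossing; it yields a collection of disjoint planar loops. An enhanced state based on $\sigma$ is a marking of each loop of $\sigma$ by $v_+$ or $v_-$. Let $C_\sigma$ be the rational vector space with basis the enhanced states based on $\sigma$ (i.e. $V^{\otimes(\text{number of loops})}$ with $V=\langle v_+,v_-\rangle$); the chain complex is $\bigoplus_\sigma C_\sigma$, graded homologically by the number of 1-smoothings minus the number of negative crossings. Differential: for each 0-smoothed crossing of $\sigma$, let $\sigma'$ be the state obtained by changing it to a 1-smoothing; the edge differential $C_\sigma\to C_{\sigma'}$ is the identity on unchanged loops, and on changed loops it is the merge $v_+\otimes v_+\mapsto v_+$, $v_+\otimes v_-\mapsto v_-$, $v_-\otimes v_+\mapsto v_-$, $v_-\otimes v_-\mapsto 0$ if two loops become one, or the split $v_+\mapsto v_+\otimes v_-+v_-\otimes v_+$, $v_-\mapsto v_-\otimes v_-$ if one loop becomes two. The differential $d$ is the sum of all edge differentials, each multiplied by the standard sign $(-1)^{r}$, where $r$ is the number of 1-smoothed crossings of $\sigma$ preceding the changed crossing in the order. Khovanov homology is the homology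 of this complex. A state cycle is an enhanced state $\alpha$ with $d(\alpha)=0$. For each crossing, its trace in a state $\sigma$ is the arc recording where the crossing was smoothed; it joins the two (possibly equal) loops of $\sigma$ passing by that crossing. It is a 1-trace if the crossing is 1-smoothed in $\sigma$. A loop of $\sigma$ is 1-tracing if it is touched by at least one 1-trace. Let $\Lambda_1$ be the graph whose vertices are the 1-tracing loops of $\sigma$ and whose edges are the 1-traces of $\sigma$ (self-loops and multiple edges allowed). A state $\sigma$ is 1-even if every circuit (closed path) in $\Lambda_1$ has even length (a 1-trace from a loop to itself counts as a circuit of length 1); a state cycle based on $\sigma$ is 1-even if $\sigma$ is. A state cycle $\alpha$ based on $\sigma$ is 1-isolated if every connected component of $\Lambda_1$ has at most one loop marked by $v_-$ in $\alpha$. *)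

theory Defs
  imports Complex_Main "HOL-Library.FuncSet"
begin

text \<open>
  The connected component of a point under the symmetric closure of a relation; an isolated
  point is a component of its own.
\<close>

definition component :: "'a rel \<Rightarrow> 'a \<Rightarrow> 'a set" where
  "component r x = (r \<union> r\<inverse>)\<^sup>* `` {x}"

definition components :: "'a set \<Rightarrow> 'a rel \<Rightarrow> 'a set set" where
  "components A r = component r ` A"


section \<open>Oriented link diagrams\<close>

text \<open>
  Link diagrams are given by signed planar diagram codes. The diagram is cut at its crossings
  into arcs, which are named by natural numbers. A crossing lists the four arc ends around it in
  counterclockwise order, starting with the end at which the under-strand enters. Seen along the
  direction of the under-strand, the four ends are therefore behind, to the right, ahead and to
  the left. At a positive crossing the over-strand runs from left to right, at a negative crossing
  from right to left.
\<close>

datatype crossing =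
  Crossing (positive: bool) (under_in: nat) (right: nat) (under_out: nat) (left: nat)

definition ends :: "crossing \<Rightarrow> nat list" where
  "ends X = [under_in X, right X, under_out X, left X]"

definition in_slots :: "crossing \<Rightarrow> nat set" where
  "in_slots X = (if positive X then {0, 3} else {0, 1})"

text \<open>
  The order of the list is the fixed order of the crossings. An arc that meets no crossing is
  a circle component without crossings.
\<close>

record diagram =
  crossings :: "crossing list"
  arcs :: "nat set"

abbreviation num_crossings :: "diagram \<Rightarrow> nat" where
  "num_crossings D \<equiv> length (crossings D)"

definition darts :: "diagram \<Rightarrow> (nat \<times> nat) set" where
  "darts D = {..<num_crossings D} \<times> {..<4}"

definition dart_arc :: "diagram \<Rightarrow> nat \<times> nat \<Rightarrow> nat" where
  "dart_arc D = (\<lambda>(c, s). ends (crossings D ! c) ! s)"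

definition incoming :: "diagram \<Rightarrow> (nat \<times> nat) set" where
  "incoming D = {(c, s) \<in> darts D. s \<in> in_slots (crossings D ! c)}"

definition outgoing :: "diagram \<Rightarrow> (nat \<times> nat) set" where
  "outgoing D = darts D - incoming D"

text \<open>Every arc that meets a crossing leaves exactly one dart and arrives at exactly one dart.\<close>

definition oriented_code :: "diagram \<Rightarrow> bool" where
  "oriented_code D \<longleftrightarrow>
     finite (arcs D) \<and> dart_arc D ` darts D \<subseteq> arcs D \<and>
     inj_on (dart_arc D) (incoming D) \<and> inj_on (dart_arc D) (outgoing D) \<and>
     dart_arc D ` incoming D = dart_arc D ` outgoing D"

text \<open>Connected pieces of the 4-valent graph underlying the diagram.\<close>

definition pieces :: "diagram \<Rightarrow> nat set set" where
  "pieces D = components {..<num_crossings D}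
     {(c, c'). \<exists>s s'. (c, s) \<in> darts D \<and> (c', s') \<in> darts D \<and>
                      dart_arc D (c, s) = dart_arc D (c', s')}"

text \<open>
  Here \<open>(c, s)\<close> stands for the corner at the crossing \<open>c\<close> between slot \<open>s\<close> and the
  counterclockwise next slot. Walking along the side of the arc at slot \<open>s + 1\<close> that bounds this
  corner leads to the corner \<open>(c', s')\<close>, where \<open>(c', s')\<close> is the other end of that arc.
\<close>

definition regions :: "diagram \<Rightarrow> (nat \<times> nat) set set" where
  "regions D = components (darts D)
     {((c, s), (c', s')). (c, s) \<in> darts D \<and> (c', s') \<in> darts D \<and>
        (c, (s + 1) mod 4) \<noteq> (c', s') \<and>
        dart_arc D (c, (s + 1) mod 4) = dart_arc D (c', s')}"

text \<open>
  Each piece has Euler characteristic at most 2, with equality iff it is planar. With \<open>n\<close> vertices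
  and \<open>2 n\<close> edges, all pieces are planar iff \<open>n - 2 n + |regions| = 2 |pieces|\<close>.
\<close>

definition planar_code :: "diagram \<Rightarrow> bool" where
  "planar_code D \<longleftrightarrow> card (regions D) = num_crossings D + 2 * card (pieces D)"

definition link_diagram :: "diagram \<Rightarrow> bool" where
  "link_diagram D \<longleftrightarrow> oriented_code D \<and> planar_code D"


section \<open>States and traces\<close>

text \<open>A state is represented by the set of its 1-smoothed crossings.\<close>

definition states :: "diagram \<Rightarrow> nat set set" where
  "states D = Pow {..<num_crossings D}"

text \<open>
  The orientation-consistent smoothing is the first pairing at a positive crossing (incoming ends
  \<open>under_in\<close>, \<open>left\<close>) and the second one at a negative crossing (incoming ends \<open>under_in\<close>,
  \<open>right\<close>).
\<close>

definition smoothing0 :: "crossing \<Rightarrow> nat rel" where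
  "smoothing0 X = {(under_in X, right X), (under_out X, left X)}"

definition smoothing1 :: "crossing \<Rightarrow> nat rel" where
  "smoothing1 X = {(under_in X, left X), (under_out X, right X)}"

definition smoothing :: "diagram \<Rightarrow> nat set \<Rightarrow> nat rel" where
  "smoothing D \<sigma> =
     (\<Union>c<num_crossings D. if c \<in> \<sigma> then smoothing1 (crossings D ! c)
                          else smoothing0 (crossings D ! c))"

text \<open>A loop of a state is identified with the set of arcs it runs through.\<close>

definition loop_of :: "diagram \<Rightarrow> nat set \<Rightarrow> nat \<Rightarrow> nat set" where
  "loop_of D \<sigma> a = component (smoothing D \<sigma>) a"

definition loops :: "diagram \<Rightarrow> nat set \<Rightarrow> nat set set" where
  "loops D \<sigma> = components (arcs D) (smoothing D \<sigma>)"

text \<open>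
  In either smoothing, the two strands at a crossing contain \<open>under_in\<close> and \<open>under_out\<close>
  respectively, so these are the loops joined by the trace of the crossing.
\<close>

definition trace_in :: "diagram \<Rightarrow> nat set \<Rightarrow> nat \<Rightarrow> nat set" where
  "trace_in D \<sigma> c = loop_of D \<sigma> (under_in (crossings D ! c))"

definition trace_out :: "diagram \<Rightarrow> nat set \<Rightarrow> nat \<Rightarrow> nat set" where
  "trace_out D \<sigma> c = loop_of D \<sigma> (under_out (crossings D ! c))"


section \<open>Khovanov homology\<close>

datatype mark = VPlus | VMinus

type_synonym enhanced_state = "nat set \<times> (nat set \<Rightarrow> mark)"

definition markings :: "diagram \<Rightarrow> nat set \<Rightarrow> (nat set \<Rightarrow> mark) set" where
  "markings D \<sigma> = loops D \<sigma> \<rightarrow>\<^sub>E UNIV"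

definition enhanced_states :: "diagram \<Rightarrow> enhanced_state set" where
  "enhanced_states D = (SIGMA \<sigma>:states D. markings D \<sigma>)"

definition num_negative :: "diagram \<Rightarrow> nat" where
  "num_negative D = card {c. c < num_crossings D \<and> \<not> positive (crossings D ! c)}"

definition hdegree :: "diagram \<Rightarrow> nat set \<Rightarrow> int" where
  "hdegree D \<sigma> = int (card \<sigma>) - int (num_negative D)"

text \<open>
  Structure constants: \<open>merge_coeff x y z\<close> is the coefficient of \<open>z\<close> in the product of \<open>x\<close> and
  \<open>y\<close>, and \<open>split_coeff x y z\<close> is the coefficient of \<open>y \<otimes> z\<close> in the coproduct of \<open>x\<close>.
\<close>

fun merge_coeff :: "mark \<Rightarrow> mark \<Rightarrow> mark \<Rightarrow> rat" where
  "merge_coeff VPlus VPlus VPlus = 1"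
| "merge_coeff VPlus VMinus VMinus = 1"
| "merge_coeff VMinus VPlus VMinus = 1"
| "merge_coeff _ _ _ = 0"

fun split_coeff :: "mark \<Rightarrow> mark \<Rightarrow> mark \<Rightarrow> rat" where
  "split_coeff VPlus VPlus VMinus = 1"
| "split_coeff VPlus VMinus VPlus = 1"
| "split_coeff VMinus VMinus VMinus = 1"
| "split_coeff _ _ _ = 0"

text \<open>
  The matrix entry, from \<open>(\<sigma>, m)\<close> to \<open>(insert c \<sigma>, m')\<close>, of the edge differential changing
  crossing \<open>c\<close>. In a planar diagram either two loops merge or one loop splits, so the last
  alternative does not arise there.
\<close>

definition edge_coeff ::
    "diagram \<Rightarrow> nat set \<Rightarrow> nat \<Rightarrow> (nat set \<Rightarrow> mark) \<Rightarrow> (nat set \<Rightarrow> mark) \<Rightarrow> rat" where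
  "edge_coeff D \<sigma> c m m' =
     (let \<tau> = insert c \<sigma>;
          a = trace_in D \<sigma> c; b = trace_out D \<sigma> c;
          a' = trace_in D \<tau> c; b' = trace_out D \<tau> c
      in if \<exists>L \<in> loops D \<sigma> \<inter> loops D \<tau>. m' L \<noteq> m L then 0
         else if a \<noteq> b \<and> a' = b' then merge_coeff (m a) (m b) (m' a')
         else if a = b \<and> a' \<noteq> b' then split_coeff (m a) (m' a') (m' b')
         else 0)"

definition edge_sign :: "nat set \<Rightarrow> nat \<Rightarrow> rat" where
  "edge_sign \<sigma> c = (-1) ^ card {j \<in> \<sigma>. j < c}"

definition d_coeff :: "diagram \<Rightarrow> enhanced_state \<Rightarrow> enhanced_state \<Rightarrow> rat" where
  "d_coeff D = (\<lambda>(\<sigma>, m) (\<tau>, m').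
     \<Sum>c \<in> {..<num_crossings D} - \<sigma>.
       if \<tau> = insert c \<sigma> \<and> m' \<in> markings D \<tau> then edge_sign \<sigma> c * edge_coeff D \<sigma> c m m' else 0)"

text \<open>
  Chains are given by their coordinates with respect to the basis of enhanced states.
\<close>

type_synonym chain = "enhanced_state \<Rightarrow> rat"

definition basis_chain :: "enhanced_state \<Rightarrow> chain" where
  "basis_chain \<alpha> = (\<lambda>e. if e = \<alpha> then 1 else 0)"

definition differential :: "diagram \<Rightarrow> chain \<Rightarrow> chain" where
  "differential D x = (\<lambda>e'. \<Sum>e \<in> enhanced_states D. x e * d_coeff D e e')"

definition chains :: "diagram \<Rightarrow> int \<Rightarrow> chain set" where
  "chains D i = {x. \<forall>e. x e \<noteq> 0 \<longrightarrow> e \<in> enhanced_states D \<and> hdegree D (fst e) = i}"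

definition cycles :: "diagram \<Rightarrow> int \<Rightarrow> chain set" where
  "cycles D i = {x \<in> chains D i. differential D x = (\<lambda>_. 0)}"

definition boundaries :: "diagram \<Rightarrow> int \<Rightarrow> chain set" where
  "boundaries D i = differential D ` chains D (i - 1)"

definition homologous :: "diagram \<Rightarrow> int \<Rightarrow> chain rel" where
  "homologous D i =
     {(x, y). x \<in> cycles D i \<and> y \<in> cycles D i \<and> (\<lambda>e. x e - y e) \<in> boundaries D i}"

definition khovanov_homology :: "diagram \<Rightarrow> int \<Rightarrow> chain set set" where
  "khovanov_homology D i = cycles D i // homologous D i"

definition homology_class :: "diagram \<Rightarrow> int \<Rightarrow> chain \<Rightarrow> chain set" where
  "homology_class D i x = homologous D i `` {x}"

definition state_cycle :: "diagram \<Rightarrow> enhanced_state \<Rightarrow> bool" where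
  "state_cycle D \<alpha> \<longleftrightarrow>
     \<alpha> \<in> enhanced_states D \<and> differential D (basis_chain \<alpha>) = (\<lambda>_. 0)"

definition nontrivial_class :: "diagram \<Rightarrow> enhanced_state \<Rightarrow> bool" where
  "nontrivial_class D \<alpha> \<longleftrightarrow>
     (let i = hdegree D (fst \<alpha>)
      in homology_class D i (basis_chain \<alpha>) \<in> khovanov_homology D i \<and>
         homology_class D i (basis_chain \<alpha>) \<noteq> homology_class D i (\<lambda>_. 0))"


section \<open>The graph of 1-traces\<close>

text \<open>
  The multigraph \<open>\<Lambda>\<^sub>1\<close> of a state \<open>\<sigma>\<close> has the set \<open>\<sigma>\<close> of 1-smoothed crossings as its edges.
\<close>

definition one_tracing :: "diagram \<Rightarrow> nat set \<Rightarrow> nat set set" where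
  "one_tracing D \<sigma> = {L \<in> loops D \<sigma>. \<exists>c \<in> \<sigma>. L = trace_in D \<sigma> c \<or> L = trace_out D \<sigma> c}"

definition trace_joins :: "diagram \<Rightarrow> nat set \<Rightarrow> nat \<Rightarrow> nat set \<Rightarrow> nat set \<Rightarrow> bool" where
  "trace_joins D \<sigma> c L M \<longleftrightarrow> {L, M} = {trace_in D \<sigma> c, trace_out D \<sigma> c}"

fun trace_walk :: "diagram \<Rightarrow> nat set \<Rightarrow> nat set \<Rightarrow> nat list \<Rightarrow> nat set \<Rightarrow> bool" where
  "trace_walk D \<sigma> L [] M \<longleftrightarrow> L = M"
| "trace_walk D \<sigma> L (c # cs) M \<longleftrightarrow>
     c \<in> \<sigma> \<and> (\<exists>N. trace_joins D \<sigma> c L N \<and> trace_walk D \<sigma> N cs M)"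

text \<open>A circuit is a nonempty closed walk without repeated edges, given by its list of edges.\<close>

definition trace_circuit :: "diagram \<Rightarrow> nat set \<Rightarrow> nat list \<Rightarrow> bool" where
  "trace_circuit D \<sigma> cs \<longleftrightarrow>
     cs \<noteq> [] \<and> distinct cs \<and> (\<exists>L \<in> one_tracing D \<sigma>. trace_walk D \<sigma> L cs L)"

definition one_even :: "diagram \<Rightarrow> nat set \<Rightarrow> bool" where
  "one_even D \<sigma> \<longleftrightarrow> (\<forall>cs. trace_circuit D \<sigma> cs \<longrightarrow> even (length cs))"

definition one_trace_components :: "diagram \<Rightarrow> nat set \<Rightarrow> nat set set set" where
  "one_trace_components D \<sigma> =
     components (one_tracing D \<sigma>) {(L, M). \<exists>c \<in> \<sigma>. trace_joins D \<sigma> c L M}"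

definition one_isolated :: "diagram \<Rightarrow> enhanced_state \<Rightarrow> bool" where
  "one_isolated D = (\<lambda>(\<sigma>, m).
     \<forall>K \<in> one_trace_components D \<sigma>. card {L \<in> K. m L = VMinus} \<le> 1)"

end

theory Submission
  imports Defs
begin

text \<open>
  Let the state cycle be given by a state \<open>\<sigma>\<close> and a marking \<open>m\<close>. It is not a boundary because
  there is a linear functional on chains that vanishes on every boundary but not on it.

  The functional is supported on the enhanced states based on \<open>\<sigma>\<close>, so only the edge differentials
  into \<open>\<sigma>\<close> matter; these come from un-doing a 1-smoothing \<open>c \<in> \<sigma>\<close>. As \<open>\<sigma>\<close> is 1-even, the graph
  \<open>\<Lambda>\<^sub>1\<close> is bipartite (\<open>two_colouring_exists\<close>): its loops carry signs \<open>\<epsilon>\<close> that are opposite at the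
  two ends of each 1-trace. In particular each \<open>c \<in> \<sigma>\<close> touches two different loops, so the edge
  differentials into \<open>\<sigma>\<close> are splits, with images spanned by \<open>v\<^sub>+ \<otimes> v\<^sub>- + v\<^sub>- \<otimes> v\<^sub>+\<close> and
  \<open>v\<^sub>- \<otimes> v\<^sub>-\<close> at the two loops touching \<open>c\<close>, tensored with any marking of the other loops.

  The functional \<open>detector\<close> sends a marking of \<open>\<sigma>\<close> to the product of the signs of its loops marked
  \<open>v\<^sub>-\<close> if it has as many \<open>v\<^sub>-\<close> as \<open>m\<close> on each component of \<open>\<Lambda>\<^sub>1\<close> and agrees with \<open>m\<close> on the loops
  that are not 1-tracing, and to \<open>0\<close> otherwise. Its value at \<open>m\<close> is
  \<open>\<plusminus>1\<close>. It kills \<open>v\<^sub>- \<otimes> v\<^sub>-\<close> since \<open>m\<close> is 1-isolated, and it kills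
  \<open>v\<^sub>+ \<otimes> v\<^sub>- + v\<^sub>- \<otimes> v\<^sub>+\<close> since the two terms have the same number of \<open>v\<^sub>-\<close> on each component and
  opposite signs (\<open>detector_swap\<close>). Hence exchanging the marks of the two loops is an involution
  that negates every term of the functional applied to the image of an edge differential
  (\<open>detector_kills_edge\<close>).
\<close>

section \<open>Components and loops\<close>

lemma component_iff: "y \<in> component r x \<longleftrightarrow> (x, y) \<in> (r \<union> r\<inverse>)\<^sup>*"
  by (simp add: component_def)

lemma component_refl: "x \<in> component r x"
  by (simp add: component_iff)

lemma component_eq:
  assumes "y \<in> component r x"
  shows "component r y = component r x"
proof -
  have "sym ((r \<union> r\<inverse>)\<^sup>*)"
    by (intro sym_rtrancl sym_Un_converse)
  then have "(x, y) \<in> (r \<union> r\<inverse>)\<^sup>*" "(y, x) \<in> (r \<union> r\<inverse>)\<^sup>*"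
    using assms by (auto simp: component_iff dest: symD)
  then show ?thesis
    by (auto simp: component_iff intro: rtrancl_trans)
qed

lemma component_subset:
  assumes "x \<in> A" and "r \<subseteq> A \<times> A"
  shows "component r x \<subseteq> A"
proof
  fix y assume "y \<in> component r x"
  then have "(x, y) \<in> (r \<union> r\<inverse>)\<^sup>*"
    by (simp add: component_iff)
  then show "y \<in> A"
    by (induction rule: rtrancl_induct) (use assms in auto)
qed

lemma finite_loops: "oriented_code D \<Longrightarrow> finite (loops D \<sigma>)"
  by (simp add: loops_def components_def oriented_code_def)

lemma crossing_ends_in_arcs:
  assumes "oriented_code D" and "c < num_crossings D"
  shows "under_in (crossings D ! c) \<in> arcs D" and "under_out (crossings D ! c) \<in> arcs D"
proof -
  have sub: "dart_arc D ` darts D \<subseteq> arcs D"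
    using assms(1) by (simp add: oriented_code_def)
  have "(c, 0) \<in> darts D" "(c, 2) \<in> darts D"
    using assms(2) by (auto simp: darts_def)
  then have "dart_arc D (c, 0) \<in> arcs D" "dart_arc D (c, 2) \<in> arcs D"
    using sub by auto
  then show "under_in (crossings D ! c) \<in> arcs D" "under_out (crossings D ! c) \<in> arcs D"
    by (simp_all add: dart_arc_def ends_def)
qed

lemma trace_ends_in_loops:
  assumes "oriented_code D" and "c < num_crossings D"
  shows "trace_in D \<sigma> c \<in> loops D \<sigma>" and "trace_out D \<sigma> c \<in> loops D \<sigma>"
  using crossing_ends_in_arcs[OF assms]
  by (auto simp: loops_def components_def trace_in_def trace_out_def loop_of_def)

lemma loop_eq_loop_of: "L \<in> loops D \<sigma> \<Longrightarrow> x \<in> L \<Longrightarrow> L = loop_of D \<sigma> x"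
  by (auto simp: loops_def components_def loop_of_def component_eq)

text \<open>The two loops created by a split are new.\<close>

lemma split_loops_new:
  assumes "trace_in D \<sigma> c = trace_out D \<sigma> c" and "trace_in D \<tau> c \<noteq> trace_out D \<tau> c"
  shows "trace_in D \<tau> c \<notin> loops D \<sigma>" and "trace_out D \<tau> c \<notin> loops D \<sigma>"
proof -
  let ?i = "under_in (crossings D ! c)" and ?o = "under_out (crossings D ! c)"
  have same: "?o \<in> loop_of D \<sigma> ?i" "?i \<in> loop_of D \<sigma> ?o"
    using assms(1) component_refl unfolding trace_in_def trace_out_def loop_of_def by metis+
  have differ: "?o \<notin> loop_of D \<tau> ?i" "?i \<notin> loop_of D \<tau> ?o"
    using assms(2) component_eq unfolding trace_in_def trace_out_def loop_of_def by metis+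
  have mem: "?i \<in> loop_of D \<tau> ?i" "?o \<in> loop_of D \<tau> ?o"
    by (simp_all add: loop_of_def component_refl)
  show "trace_in D \<tau> c \<notin> loops D \<sigma>" "trace_out D \<tau> c \<notin> loops D \<sigma>"
    using same differ mem loop_eq_loop_of unfolding trace_in_def trace_out_def by metis+
qed


section \<open>Bipartiteness of the graph of 1-traces\<close>

lemma trace_joins_sym: "trace_joins D \<sigma> c L M \<longleftrightarrow> trace_joins D \<sigma> c M L"
  by (simp add: trace_joins_def insert_commute)

lemma trace_walk_append:
  "trace_walk D \<sigma> L (cs @ ds) M \<longleftrightarrow>
     (\<exists>N. trace_walk D \<sigma> L cs N \<and> trace_walk D \<sigma> N ds M)"
  by (induction cs arbitrary: L) auto

lemma trace_walk_rev: "trace_walk D \<sigma> L cs M \<Longrightarrow> trace_walk D \<sigma> M (rev cs) L"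
proof (induction cs arbitrary: L)
  case (Cons c cs)
  then obtain N where "c \<in> \<sigma>" "trace_joins D \<sigma> c L N" "trace_walk D \<sigma> M (rev cs) N"
    by auto
  then show ?case
    by (auto simp: trace_walk_append trace_joins_sym)
qed simp

text \<open>
  Circuits do not repeat edges. A closed walk that repeats an edge is cut at two occurrences of that
  edge into two shorter closed walks; how they are formed depends on whether the edge is traversed
  twice in the same direction or in opposite ones.
\<close>

lemma closed_trace_walk_even:
  assumes "oriented_code D" and "\<sigma> \<subseteq> {..<num_crossings D}" and "one_even D \<sigma>"
  shows "trace_walk D \<sigma> L cs L \<Longrightarrow> even (length cs)"
proof (induction "length cs" arbitrary: L cs rule: less_induct)
  case less
  note IH = less.hyps
  note walk = less.prems
  show ?case
  proof (cases "distinct cs")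
    case True
    show ?thesis
    proof (cases cs)
      case (Cons c ds)
      then obtain N where c: "c \<in> \<sigma>" "{L, N} = {trace_in D \<sigma> c, trace_out D \<sigma> c}"
        using walk by (auto simp: trace_joins_def)
      then have "L = trace_in D \<sigma> c \<or> L = trace_out D \<sigma> c"
        by auto
      moreover have "c < num_crossings D"
        using c(1) assms(2) by auto
      ultimately have "L \<in> one_tracing D \<sigma>"
        using c(1) trace_ends_in_loops[OF assms(1)] by (auto simp: one_tracing_def)
      then have "trace_circuit D \<sigma> cs"
        using Cons True walk by (auto simp: trace_circuit_def)
      then show ?thesis
        using assms(3) by (simp add: one_even_def)
    qed simp
  next
    case False
    then obtain xs ys zs c where cs: "cs = xs @ [c] @ ys @ [c] @ zs"
      using not_distinct_decomp by blast
    then obtain A B A' B' where w: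
      "trace_walk D \<sigma> L xs A" "c \<in> \<sigma>" "trace_joins D \<sigma> c A B" "trace_walk D \<sigma> B ys A'"
      "trace_joins D \<sigma> c A' B'" "trace_walk D \<sigma> B' zs L"
      using walk by (auto simp: trace_walk_append)
    then have "A' = A \<and> B' = B \<or> A' = B \<and> B' = A"
      by (auto simp: trace_joins_def doubleton_eq_iff)
    then show ?thesis
    proof (elim disjE conjE)
      assume "A' = A" "B' = B"
      then have "trace_walk D \<sigma> A (c # ys) A" "trace_walk D \<sigma> L (xs @ c # zs) L"
        using w by (auto simp: trace_walk_append)
      then have "even (length (c # ys))" "even (length (xs @ c # zs))"
        using IH[of "c # ys" A] IH[of "xs @ c # zs" L] by (simp_all add: cs del: trace_walk.simps)
      then show ?thesis
        by (simp add: cs)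
    next
      assume "A' = B" "B' = A"
      then have "trace_walk D \<sigma> B ys B" "trace_walk D \<sigma> L (xs @ zs) L"
        using w by (auto simp: trace_walk_append)
      then have "even (length ys)" "even (length (xs @ zs))"
        using IH[of ys B] IH[of "xs @ zs" L] by (simp_all add: cs)
      then show ?thesis
        by (simp add: cs)
    qed
  qed
qed

text \<open>
  The sign of a loop is the parity of the length of a walk to it from a fixed base loop of its
  component.
\<close>

lemma two_colouring_exists:
  assumes "oriented_code D" and "\<sigma> \<subseteq> {..<num_crossings D}" and "one_even D \<sigma>"
  obtains \<epsilon> :: "nat set \<Rightarrow> rat"
  where "\<And>L. \<epsilon> L = 1 \<or> \<epsilon> L = -1"
    and "\<And>c. c \<in> \<sigma> \<Longrightarrow> \<epsilon> (trace_out D \<sigma> c) = - \<epsilon> (trace_in D \<sigma> c)"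
proof -
  define reach where "reach L M \<longleftrightarrow> (\<exists>cs. trace_walk D \<sigma> L cs M)" for L M
  define base where "base L = (SOME M. reach L M)" for L
  define path where "path L = (SOME cs. trace_walk D \<sigma> (base L) cs L)" for L
  define \<epsilon> :: "nat set \<Rightarrow> rat" where "\<epsilon> L = (-1) ^ length (path L)" for L
  have reach_refl: "reach L L" for L
    unfolding reach_def by (rule exI[of _ "[]"]) simp
  have reach_sym: "reach M L" if "reach L M" for L M
    using that trace_walk_rev unfolding reach_def by blast
  have reach_trans: "reach L N" if "reach L M" "reach M N" for L M N
    using that trace_walk_append unfolding reach_def by blast
  have base_eq: "base L = base M" if "reach L M" for L M
  proof -
    have "reach L = reach M"
      using that reach_sym reach_trans by blast
    then show ?thesis
      by (simp add: base_def)
  qed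
  have path: "trace_walk D \<sigma> (base L) (path L) L" for L
  proof -
    have "reach L (base L)"
      unfolding base_def by (rule someI[of _ L]) (rule reach_refl)
    then have "\<exists>cs. trace_walk D \<sigma> (base L) cs L"
      using reach_sym reach_def by blast
    then show ?thesis
      unfolding path_def by (rule someI_ex)
  qed
  have "\<epsilon> (trace_out D \<sigma> c) = - \<epsilon> (trace_in D \<sigma> c)" if c: "c \<in> \<sigma>" for c
  proof -
    let ?a = "trace_in D \<sigma> c" and ?b = "trace_out D \<sigma> c"
    have step: "trace_walk D \<sigma> ?a [c] ?b"
      using c by (simp add: trace_joins_def)
    then have "base ?a = base ?b"
      using base_eq reach_def by blast
    then have "trace_walk D \<sigma> (base ?a) (path ?a @ [c] @ rev (path ?b)) (base ?a)"
      using path[of ?a] step trace_walk_rev[OF path[of ?b]]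
      unfolding trace_walk_append by metis
    then have "even (length (path ?a @ [c] @ rev (path ?b)))"
      by (rule closed_trace_walk_even[OF assms])
    then have "even (length (path ?b)) \<longleftrightarrow> odd (length (path ?a))"
      by simp
    then show ?thesis
      by (cases "even (length (path ?a))") (simp_all add: \<epsilon>_def)
  qed
  moreover have "\<epsilon> L = 1 \<or> \<epsilon> L = -1" for L
    by (cases "even (length (path L))") (simp_all add: \<epsilon>_def)
  ultimately show thesis
    using that by blast
qed


section \<open>The detecting functional\<close>

text \<open>
  The component of \<open>\<Lambda>\<^sub>1\<close> containing a loop, and the number of its loops marked \<open>v\<^sub>-\<close>. A loop that is
  not 1-tracing is counted as a component of its own.
\<close>

definition trace_component :: "diagram \<Rightarrow> nat set \<Rightarrow> nat set \<Rightarrow> nat set set" where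
  "trace_component D \<sigma> L = component {(L, M). \<exists>c \<in> \<sigma>. trace_joins D \<sigma> c L M} L"

definition num_minus :: "diagram \<Rightarrow> nat set \<Rightarrow> (nat set \<Rightarrow> mark) \<Rightarrow> nat set \<Rightarrow> nat" where
  "num_minus D \<sigma> m L = card {M \<in> trace_component D \<sigma> L. m M = VMinus}"

text \<open>
  The value at the enhanced state \<open>(\<sigma>, n)\<close> of the functional that detects \<open>(\<sigma>, m)\<close>, for a sign
  \<open>\<epsilon> L\<close> attached to each loop \<open>L\<close>. Outside \<open>\<sigma>\<close> the functional is zero.
\<close>

definition detector ::
    "diagram \<Rightarrow> nat set \<Rightarrow> (nat set \<Rightarrow> rat) \<Rightarrow> (nat set \<Rightarrow> mark) \<Rightarrow> (nat set \<Rightarrow> mark) \<Rightarrow> rat" where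
  "detector D \<sigma> \<epsilon> m n =
     (if \<forall>L \<in> loops D \<sigma>. num_minus D \<sigma> n L = num_minus D \<sigma> m L
      then \<Prod>L \<in> loops D \<sigma>. if n L = VMinus then \<epsilon> L else 1
      else 0)"

text \<open>The marking obtained by exchanging the marks of two loops.\<close>

definition swap_marks :: "nat set \<Rightarrow> nat set \<Rightarrow> (nat set \<Rightarrow> mark) \<Rightarrow> nat set \<Rightarrow> mark" where
  "swap_marks a b n = n(a := n b, b := n a)"

lemma swap_marks_involution: "swap_marks a b (swap_marks a b n) = n"
  by (auto simp: swap_marks_def)

lemma swap_marks_in_markings:
  "a \<in> loops D \<sigma> \<Longrightarrow> b \<in> loops D \<sigma> \<Longrightarrow> n \<in> markings D \<sigma> \<Longrightarrow> swap_marks a b n \<in> markings D \<sigma>"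
  by (auto simp: markings_def swap_marks_def PiE_def extensional_def)

lemma finite_markings:
  assumes "oriented_code D"
  shows "finite (markings D \<sigma>)"
proof -
  have "(UNIV :: mark set) = {VPlus, VMinus}"
    using mark.exhaust by auto
  then have "finite (UNIV :: mark set)"
    by (metis finite.emptyI finite.insertI)
  then show ?thesis
    unfolding markings_def by (intro finite_PiE finite_loops assms)
qed

lemma trace_component_subset_loops:
  assumes "oriented_code D" and "\<sigma> \<subseteq> {..<num_crossings D}" and "L \<in> loops D \<sigma>"
  shows "trace_component D \<sigma> L \<subseteq> loops D \<sigma>"
  unfolding trace_component_def
proof (rule component_subset[OF assms(3)], clarify)
  fix M N c assume "c \<in> \<sigma>" "trace_joins D \<sigma> c M N"
  moreover from this have "{M, N} = {trace_in D \<sigma> c, trace_out D \<sigma> c}"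
    by (simp add: trace_joins_def)
  ultimately show "M \<in> loops D \<sigma> \<and> N \<in> loops D \<sigma>"
    using trace_ends_in_loops[OF assms(1), of c \<sigma>] assms(2) by (auto simp: doubleton_eq_iff)
qed

lemma trace_ends_same_component:
  assumes "c \<in> \<sigma>"
  shows "trace_in D \<sigma> c \<in> trace_component D \<sigma> L \<longleftrightarrow> trace_out D \<sigma> c \<in> trace_component D \<sigma> L"
proof -
  define r where "r = {(L, M). \<exists>c \<in> \<sigma>. trace_joins D \<sigma> c L M}"
  have "(trace_in D \<sigma> c, trace_out D \<sigma> c) \<in> r"
    using assms by (auto simp: r_def trace_joins_def)
  then have "(trace_in D \<sigma> c, trace_out D \<sigma> c) \<in> r \<union> r\<inverse>"
    "(trace_out D \<sigma> c, trace_in D \<sigma> c) \<in> r \<union> r\<inverse>"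
    by auto
  then show ?thesis
    unfolding trace_component_def r_def[symmetric] component_iff
    by (meson rtrancl.rtrancl_into_rtrancl)
qed

lemma num_minus_le_one:
  assumes "one_isolated D (\<sigma>, m)" and "L \<in> loops D \<sigma>"
  shows "num_minus D \<sigma> m L \<le> 1"
proof (cases "L \<in> one_tracing D \<sigma>")
  case True
  then have "trace_component D \<sigma> L \<in> one_trace_components D \<sigma>"
    by (auto simp: trace_component_def one_trace_components_def components_def)
  then show ?thesis
    using assms(1) by (auto simp: one_isolated_def num_minus_def)
next
  case False
  \<comment> \<open>No 1-trace touches \<open>L\<close>, so that its component is \<open>{L}\<close>.\<close>
  define r where "r = {(L, M). \<exists>c \<in> \<sigma>. trace_joins D \<sigma> c L M}"
  have untouched: "(L, M) \<notin> r \<union> r\<inverse>" for M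
    using False assms(2) by (auto simp: r_def trace_joins_def one_tracing_def doubleton_eq_iff)
  have "x = L" if "(L, x) \<in> (r \<union> r\<inverse>)\<^sup>*" for x
    using that by (rule converse_rtranclE) (use untouched in blast)+
  then have "trace_component D \<sigma> L \<subseteq> {L}"
    unfolding trace_component_def r_def[symmetric] by (simp add: subset_iff component_iff)
  then have "{M \<in> trace_component D \<sigma> L. m M = VMinus} \<subseteq> {L}"
    by blast
  then show ?thesis
    unfolding num_minus_def using card_mono[of "{L}"] by force
qed

lemma num_minus_swap:
  assumes "a \<in> trace_component D \<sigma> L \<longleftrightarrow> b \<in> trace_component D \<sigma> L"
  shows "num_minus D \<sigma> (swap_marks a b n) L = num_minus D \<sigma> n L"
proof -
  define K where "K = trace_component D \<sigma> L"
  let ?\<pi> = "id(a := b, b := a)"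
  have "bij_betw ?\<pi> {M \<in> K. swap_marks a b n M = VMinus} {M \<in> K. n M = VMinus}"
    by (rule bij_betwI[where g = ?\<pi>])
       (use assms in \<open>auto simp: K_def swap_marks_def split: if_splits\<close>)
  then show ?thesis
    unfolding num_minus_def K_def by (rule bij_betw_same_card)
qed

text \<open>
  If both loops at a 1-trace are marked \<open>v\<^sub>-\<close>, their component has more \<open>v\<^sub>-\<close> than a 1-isolated
  marking allows.
\<close>

lemma detector_both_minus:
  assumes "oriented_code D" and "\<sigma> \<subseteq> {..<num_crossings D}" and "one_isolated D (\<sigma>, m)"
    and "c \<in> \<sigma>" and "trace_in D \<sigma> c \<noteq> trace_out D \<sigma> c"
    and "n (trace_in D \<sigma> c) = VMinus" and "n (trace_out D \<sigma> c) = VMinus"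
  shows "detector D \<sigma> \<epsilon> m n = 0"
proof -
  let ?a = "trace_in D \<sigma> c" and ?b = "trace_out D \<sigma> c"
  let ?K = "trace_component D \<sigma> ?a"
  have a: "?a \<in> loops D \<sigma>"
    using trace_ends_in_loops[OF assms(1), of c \<sigma>] assms(2,4) by auto
  have "?a \<in> ?K"
    by (simp add: trace_component_def component_refl)
  moreover from this have "?b \<in> ?K"
    using trace_ends_same_component[OF assms(4)] by blast
  ultimately have "{?a, ?b} \<subseteq> {M \<in> ?K. n M = VMinus}"
    using assms(6,7) by auto
  moreover have "finite {M \<in> ?K. n M = VMinus}"
    using trace_component_subset_loops[OF assms(1,2) a] finite_loops[OF assms(1)]
    by (auto intro: finite_subset)
  ultimately have "card {?a, ?b} \<le> num_minus D \<sigma> n ?a"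
    unfolding num_minus_def by (intro card_mono)
  moreover have "num_minus D \<sigma> m ?a \<le> 1"
    using num_minus_le_one[OF assms(3) a] .
  moreover have "card {?a, ?b} = 2"
    using assms(5) by simp
  ultimately have "num_minus D \<sigma> n ?a \<noteq> num_minus D \<sigma> m ?a"
    by linarith
  then show ?thesis
    using a by (auto simp: detector_def)
qed

lemma detector_swap:
  assumes "oriented_code D" and "\<sigma> \<subseteq> {..<num_crossings D}" and "c \<in> \<sigma>"
    and "trace_in D \<sigma> c \<noteq> trace_out D \<sigma> c"
    and "\<epsilon> (trace_out D \<sigma> c) = - \<epsilon> (trace_in D \<sigma> c)"
    and "n (trace_in D \<sigma> c) \<noteq> n (trace_out D \<sigma> c)"
  shows "detector D \<sigma> \<epsilon> m (swap_marks (trace_in D \<sigma> c) (trace_out D \<sigma> c) n)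
         = - detector D \<sigma> \<epsilon> m n"
proof -
  define a where "a = trace_in D \<sigma> c"
  define b where "b = trace_out D \<sigma> c"
  define weight where "weight n L = (if n L = VMinus then \<epsilon> L else 1)" for n L
  have ab: "a \<in> loops D \<sigma>" "b \<in> loops D \<sigma>"
    using trace_ends_in_loops[OF assms(1), of c \<sigma>] assms(2,3) by (auto simp: a_def b_def)
  have neq: "a \<noteq> b"
    using assms(4) by (simp add: a_def b_def)
  have count: "num_minus D \<sigma> (swap_marks a b n) L = num_minus D \<sigma> n L" for L
    by (rule num_minus_swap)
       (use trace_ends_same_component[OF assms(3)] in \<open>simp add: a_def b_def\<close>)
  have split: "(\<Prod>L \<in> loops D \<sigma>. weight k L)
      = weight k a * weight k b * (\<Prod>L \<in> loops D \<sigma> - {a, b}. weight k L)" for k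
  proof -
    have "(\<Prod>L \<in> loops D \<sigma>. weight k L)
        = (\<Prod>L \<in> loops D \<sigma> - {a, b}. weight k L) * (\<Prod>L \<in> {a, b}. weight k L)"
      by (rule prod.subset_diff) (use ab finite_loops[OF assms(1)] in auto)
    then show ?thesis
      using neq by simp
  qed
  have rest: "(\<Prod>L \<in> loops D \<sigma> - {a, b}. weight (swap_marks a b n) L)
      = (\<Prod>L \<in> loops D \<sigma> - {a, b}. weight n L)"
    by (rule prod.cong) (auto simp: weight_def swap_marks_def)
  have "weight (swap_marks a b n) a * weight (swap_marks a b n) b = - (weight n a * weight n b)"
    using assms(5,6) neq unfolding a_def[symmetric] b_def[symmetric]
    by (cases "n a"; cases "n b") (simp_all add: weight_def swap_marks_def)
  then have "(\<Prod>L \<in> loops D \<sigma>. weight (swap_marks a b n) L) = - (\<Prod>L \<in> loops D \<sigma>. weight n L)"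
    by (simp add: split rest)
  then show ?thesis
    unfolding detector_def a_def[symmetric] b_def[symmetric] count
    by (simp add: weight_def)
qed

lemma split_coeff_sym: "split_coeff x y z = split_coeff x z y"
  by (cases x; cases y; cases z) simp_all

lemma detector_kills_edge:
  assumes "oriented_code D" and "\<sigma> \<subseteq> {..<num_crossings D}" and "one_isolated D (\<sigma>, m)"
    and "\<sigma> = insert c \<rho>"
    and "trace_in D \<sigma> c \<noteq> trace_out D \<sigma> c"
    and "\<epsilon> (trace_out D \<sigma> c) = - \<epsilon> (trace_in D \<sigma> c)"
  shows "(\<Sum>n \<in> markings D \<sigma>. detector D \<sigma> \<epsilon> m n * edge_coeff D \<rho> c k n) = 0"
proof (cases "trace_in D \<rho> c = trace_out D \<rho> c")
  case False
  \<comment> \<open>Two loops before and after the change: the edge coefficient is zero by convention.\<close>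
  then have "edge_coeff D \<rho> c k n = 0" for n
    using assms(5) unfolding edge_coeff_def Let_def assms(4)[symmetric] by auto
  then show ?thesis
    by simp
next
  case True
  define a where "a = trace_in D \<sigma> c"
  define b where "b = trace_out D \<sigma> c"
  have c: "c \<in> \<sigma>"
    using assms(4) by simp
  have ab: "a \<in> loops D \<sigma>" "b \<in> loops D \<sigma>"
    using trace_ends_in_loops[OF assms(1), of c \<sigma>] assms(2) c by (auto simp: a_def b_def)
  have neq: "a \<noteq> b"
    using assms(5) by (simp add: a_def b_def)
  have new: "a \<notin> loops D \<rho>" "b \<notin> loops D \<rho>"
    using split_loops_new[OF True assms(5)] by (simp_all add: a_def b_def)
  have coeff: "edge_coeff D \<rho> c k n =
      (if \<exists>L \<in> loops D \<rho> \<inter> loops D \<sigma>. n L \<noteq> k L then 0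
       else split_coeff (k (trace_in D \<rho> c)) (n a) (n b))" for n
    using True neq unfolding edge_coeff_def Let_def assms(4)[symmetric] a_def b_def by simp
  have "(\<exists>L \<in> loops D \<rho> \<inter> loops D \<sigma>. swap_marks a b n L \<noteq> k L) \<longleftrightarrow>
      (\<exists>L \<in> loops D \<rho> \<inter> loops D \<sigma>. n L \<noteq> k L)" for n
    using new unfolding swap_marks_def by (metis IntD1 fun_upd_apply)
  then have coeff_swap: "edge_coeff D \<rho> c k (swap_marks a b n) = edge_coeff D \<rho> c k n" for n
    using neq split_coeff_sym unfolding coeff by (simp add: swap_marks_def)
  define contrib where "contrib n = detector D \<sigma> \<epsilon> m n * edge_coeff D \<rho> c k n" for n
  have negate: "contrib (swap_marks a b n) = - contrib n" for n
  proof (cases "n a = n b")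
    case True
    then have same: "swap_marks a b n = n"
      by (auto simp: swap_marks_def)
    have "contrib n = 0"
    proof (cases "n a")
      case VPlus
      then have "edge_coeff D \<rho> c k n = 0"
        using True unfolding coeff by (cases "k (trace_in D \<rho> c)") simp_all
      then show ?thesis
        by (simp add: contrib_def)
    next
      case VMinus
      then have "detector D \<sigma> \<epsilon> m n = 0"
        using detector_both_minus[OF assms(1,2,3) c assms(5)] True by (simp add: a_def b_def)
      then show ?thesis
        by (simp add: contrib_def)
    qed
    then show ?thesis
      by (simp add: same)
  next
    case False
    then have "detector D \<sigma> \<epsilon> m (swap_marks a b n) = - detector D \<sigma> \<epsilon> m n"
      using detector_swap[OF assms(1,2) c assms(5), of \<epsilon> n m] assms(6)
      by (simp add: a_def b_def)
    then show ?thesis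
      by (simp add: contrib_def coeff_swap)
  qed
  have "(\<Sum>n \<in> markings D \<sigma>. contrib n) = (\<Sum>n \<in> markings D \<sigma>. contrib (swap_marks a b n))"
    by (rule sum.reindex_bij_witness[of _ "swap_marks a b" "swap_marks a b"])
       (simp_all add: swap_marks_involution swap_marks_in_markings ab)
  then have "(\<Sum>n \<in> markings D \<sigma>. contrib n) = - (\<Sum>n \<in> markings D \<sigma>. contrib n)"
    by (simp add: negate sum_negf)
  then show ?thesis
    by (simp add: contrib_def)
qed

lemma detector_kills_boundary:
  assumes "oriented_code D" and "\<sigma> \<subseteq> {..<num_crossings D}" and "one_isolated D (\<sigma>, m)"
    and "\<And>L. \<epsilon> L = 1 \<or> \<epsilon> L = -1"
    and "\<And>c. c \<in> \<sigma> \<Longrightarrow> \<epsilon> (trace_out D \<sigma> c) = - \<epsilon> (trace_in D \<sigma> c)"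
  shows "(\<Sum>n \<in> markings D \<sigma>. detector D \<sigma> \<epsilon> m n * differential D x (\<sigma>, n)) = 0"
proof -
  have entry: "(\<Sum>n \<in> markings D \<sigma>. detector D \<sigma> \<epsilon> m n * d_coeff D (\<rho>, k) (\<sigma>, n)) = 0" for \<rho> k
  proof -
    have "(\<Sum>n \<in> markings D \<sigma>. detector D \<sigma> \<epsilon> m n * d_coeff D (\<rho>, k) (\<sigma>, n)) =
        (\<Sum>n \<in> markings D \<sigma>. \<Sum>c \<in> {..<num_crossings D} - \<rho>. if \<sigma> = insert c \<rho>
          then edge_sign \<rho> c * (detector D \<sigma> \<epsilon> m n * edge_coeff D \<rho> c k n) else 0)"
      by (rule sum.cong) (auto simp: d_coeff_def sum_distrib_left intro!: sum.cong)
    also have "\<dots> = (\<Sum>c \<in> {..<num_crossings D} - \<rho>. if \<sigma> = insert c \<rho>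
        then edge_sign \<rho> c * (\<Sum>n \<in> markings D \<sigma>. detector D \<sigma> \<epsilon> m n * edge_coeff D \<rho> c k n)
        else 0)"
      by (subst sum.swap) (auto simp: sum_distrib_left intro!: sum.cong)
    also have "\<dots> = 0"
    proof (rule sum.neutral, intro ballI)
      fix c
      show "(if \<sigma> = insert c \<rho>
          then edge_sign \<rho> c * (\<Sum>n \<in> markings D \<sigma>. detector D \<sigma> \<epsilon> m n * edge_coeff D \<rho> c k n)
          else 0) = 0"
      proof (cases "\<sigma> = insert c \<rho>")
        case True
        then have "\<epsilon> (trace_out D \<sigma> c) = - \<epsilon> (trace_in D \<sigma> c)"
          using assms(5) by blast
        moreover from this have "trace_in D \<sigma> c \<noteq> trace_out D \<sigma> c"
          using assms(4)[of "trace_in D \<sigma> c"] by auto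
        ultimately have
          "(\<Sum>n \<in> markings D \<sigma>. detector D \<sigma> \<epsilon> m n * edge_coeff D \<rho> c k n) = 0"
          by (intro detector_kills_edge[OF assms(1-3) True])
        then show ?thesis
          by (simp only: mult_zero_right if_cancel)
      qed simp
    qed
    finally show ?thesis .
  qed
  have "(\<Sum>n \<in> markings D \<sigma>. detector D \<sigma> \<epsilon> m n * differential D x (\<sigma>, n)) =
      (\<Sum>n \<in> markings D \<sigma>. \<Sum>e \<in> enhanced_states D.
        x e * (detector D \<sigma> \<epsilon> m n * d_coeff D e (\<sigma>, n)))"
    by (simp add: differential_def sum_distrib_left mult.left_commute)
  also have "\<dots> = (\<Sum>e \<in> enhanced_states D.
      x e * (\<Sum>n \<in> markings D \<sigma>. detector D \<sigma> \<epsilon> m n * d_coeff D e (\<sigma>, n)))"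
    by (subst sum.swap) (simp add: sum_distrib_left)
  also have "\<dots> = 0"
    by (rule sum.neutral) (use entry in auto)
  finally show ?thesis .
qed

lemma detector_self_nonzero:
  assumes "oriented_code D" and "\<And>L. \<epsilon> L = 1 \<or> \<epsilon> L = -1"
  shows "detector D \<sigma> \<epsilon> m m \<noteq> 0"
proof -
  have "\<epsilon> L \<noteq> 0" for L
    using assms(2)[of L] by auto
  then show ?thesis
    using finite_loops[OF assms(1)] by (simp add: detector_def)
qed

section \<open>Nontriviality of the homology class\<close>

theorem theorem4p3:
  fixes D :: diagram and \<alpha> :: enhanced_state
  assumes "link_diagram D"
    and "state_cycle D \<alpha>"
    and "one_even D (fst \<alpha>)"
    and "one_isolated D \<alpha>"
  shows "nontrivial_class D \<alpha>"
proof -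
  obtain \<sigma> m where \<alpha>: "\<alpha> = (\<sigma>, m)"
    by (cases \<alpha>)
  have oriented: "oriented_code D"
    using assms(1) by (simp add: link_diagram_def)
  have mem: "\<alpha> \<in> enhanced_states D" and closed: "differential D (basis_chain \<alpha>) = (\<lambda>_. 0)"
    using assms(2) by (simp_all add: state_cycle_def)
  then have \<sigma>: "\<sigma> \<subseteq> {..<num_crossings D}" and m: "m \<in> markings D \<sigma>"
    by (auto simp: \<alpha> enhanced_states_def states_def)
  define i where "i = hdegree D \<sigma>"
  have cycle: "basis_chain \<alpha> \<in> cycles D i"
    using mem closed by (auto simp: cycles_def chains_def basis_chain_def i_def \<alpha>)
  have zero: "(\<lambda>_. 0) \<in> boundaries D i" "(\<lambda>_. 0) \<in> cycles D i"
  proof -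
    have "differential D (\<lambda>_. 0) = (\<lambda>_. 0)"
      by (simp add: differential_def)
    then show "(\<lambda>_. 0) \<in> boundaries D i" "(\<lambda>_. 0) \<in> cycles D i"
      unfolding boundaries_def cycles_def chains_def by (auto intro!: image_eqI[of _ _ "\<lambda>_. 0"])
  qed
  obtain \<epsilon> where \<epsilon>: "\<And>L. \<epsilon> L = (1 :: rat) \<or> \<epsilon> L = -1"
      "\<And>c. c \<in> \<sigma> \<Longrightarrow> \<epsilon> (trace_out D \<sigma> c) = - \<epsilon> (trace_in D \<sigma> c)"
    using two_colouring_exists[OF oriented \<sigma>] assms(3) \<alpha> by auto
  have not_boundary: "(\<lambda>e. 0 - basis_chain \<alpha> e) \<notin> boundaries D i"
  proof
    assume "(\<lambda>e. 0 - basis_chain \<alpha> e) \<in> boundaries D i"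
    then obtain x where x: "differential D x = (\<lambda>e. 0 - basis_chain \<alpha> e)"
      by (auto simp: boundaries_def)
    have "0 = (\<Sum>n \<in> markings D \<sigma>. detector D \<sigma> \<epsilon> m n * differential D x (\<sigma>, n))"
      using detector_kills_boundary[OF oriented \<sigma> _ \<epsilon>] assms(4) \<alpha> by simp
    also have "\<dots> = (\<Sum>n \<in> markings D \<sigma>. if n = m then - detector D \<sigma> \<epsilon> m n else 0)"
      by (rule sum.cong) (auto simp: x basis_chain_def \<alpha>)
    also have "\<dots> = - detector D \<sigma> \<epsilon> m m"
      using m finite_markings[OF oriented] by simp
    finally show False
      using detector_self_nonzero[OF oriented \<epsilon>(1)] by simp
  qed
  have "basis_chain \<alpha> \<in> homology_class D i (basis_chain \<alpha>)"
    using cycle zero(1) by (simp add: homology_class_def homologous_def)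
  moreover have "basis_chain \<alpha> \<notin> homology_class D i (\<lambda>_. 0)"
    using not_boundary by (simp add: homology_class_def homologous_def)
  ultimately have "homology_class D i (basis_chain \<alpha>) \<noteq> homology_class D i (\<lambda>_. 0)"
    by blast
  moreover have "homology_class D i (basis_chain \<alpha>) \<in> khovanov_homology D i"
    unfolding homology_class_def khovanov_homology_def using cycle by (rule quotientI)
  ultimately show ?thesis
    by (simp add: nontrivial_class_def i_def \<alpha>)
qed

end
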